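(* Let $C$ be a nonempty subset of a smooth and strictly convex real Banach space $E$ and $T\colon C\to E$ a mapping such that the fixed point set $\mathrm{F}(T)$ is nonempty. Then the following are equivalent: (1) $T$ is strongly quasinonexpansive with respect to $\phi$; (2) $T$ is quasinonexpansive with respect to $\phi$, and for every $z\in\mathrm{F}(T)$, every $M>0$ and every sequence $\{x_n\}$ in $C\cap\bar{B}(z,M)$ with $\phi(z,x_n)-\phi(z,Tx_n)\to 0$, one has $\phi(Tx_n,x_n)\to 0$; (3) for any $z\in\mathrm{F}(T)$ and $M>0$ there exists a nondecreasing bounded function $\gamma\colon[0,\alpha]\to\mathbb{R}_+$ such that $\gamma(t)>0$ for all $t\in(0,\alpha]$ and \[\gamma\bigl(\phi(Tx,x)\bigr)\le\phi(z,x)-\phi(z,Tx)\] for all $x\in D$, where $D=C\cap\bar{B}(z,M)$ and $\alpha=\sup\{\phi(Tx,x):x\in D\}$.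
   Context: $\mathbb{R}_+$ is the set of nonnegative real numbers. For a smooth real Banach space $E$ with dual $E^*$, the (normalized) duality mapping $J\colon E\to E^*$ is single-valued: $Jx$ is the unique $x^*\in E^*$ with $\langle x,x^*\rangle=\|x\|^2=\|x^*\|^2$, where $\langle x,x^*\rangle$ is the value of $x^*$ at $x$. The function $\phi\colon E\times E\to\mathbb{R}_+$ is $\phi(x,y)=\|x\|^2-2\langle x,Jy\rangle+\|y\|^2$, and $\bar{B}(z,M)=\{x\in E:\phi(z,x)\le M\}$ for $z\in E$, $M>0$ (defined via $\phi$, not the norm). $\mathrm{F}(T)=\{z\in C: z=Tz\}$. $T$ is quasinonexpansive with respect to $\phi$ if $\mathrm{F}(T)\neq\emptyset$ and $\phi(z,Tx)\le\phi(z,x)$ for all $z\in\mathrm{F}(T)$, $x\in C$. $T$ is strongly quasinonexpansive with respect to $\phi$ if $\mathrm{F}(T)\neq\emptyset$ and for any $z\in\mathrm{F}(T)$, $M>0$ and $\epsilon>0$ there exists $\delta>0$ such that $x\in C\cap\bar{B}(z,M)$ and $\phi(z,x)-\phi(z,Tx)<\delta$ imply $\phi(Tx,x)<\epsilon$. *)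

theory Defs
  imports "HOL-Analysis.Analysis"
begin

text \<open>The dual of a real Banach space \<open>'a\<close> is the type \<open>'a \<Rightarrow>\<^sub>L real\<close> of bounded linear
  functionals with the operator norm.\<close>

text \<open>Smoothness is Gateaux differentiability of the norm: the two-sided limit exists for all
  points and directions in the unit sphere.\<close>

definition smooth_space :: "'a::real_normed_vector itself \<Rightarrow> bool" where
  "smooth_space _ \<longleftrightarrow>
     (\<forall>x\<in>sphere (0::'a) 1. \<forall>y\<in>sphere (0::'a) 1.
        \<exists>l. ((\<lambda>t::real. (norm (x + t *\<^sub>R y) - norm x) / t) \<longlongrightarrow> l) (at 0))"

definition strictly_convex_space :: "'a::real_normed_vector itself \<Rightarrow> bool" where
  "strictly_convex_space _ \<longleftrightarrow>
     (\<forall>x\<in>sphere (0::'a) 1. \<forall>y\<in>sphere (0::'a) 1. x \<noteq> y \<longrightarrow> norm ((1/2) *\<^sub>R (x + y)) < 1)"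

text \<open>The description is proper on smooth spaces; elsewhere the functional need not be unique
  and \<open>duality_map\<close> is unspecified.\<close>

definition duality_map :: "'a::real_normed_vector \<Rightarrow> ('a \<Rightarrow>\<^sub>L real)" where
  "duality_map x = (THE f. blinfun_apply f x = (norm x)\<^sup>2 \<and> (norm x)\<^sup>2 = (norm f)\<^sup>2)"

definition phi :: "'a::real_normed_vector \<Rightarrow> 'a \<Rightarrow> real" where
  "phi x y = (norm x)\<^sup>2 - 2 * blinfun_apply (duality_map y) x + (norm y)\<^sup>2"

definition phi_ball :: "'a::real_normed_vector \<Rightarrow> real \<Rightarrow> 'a set" where
  "phi_ball z M = {x. phi z x \<le> M}"

text \<open>A mapping from \<open>C\<close> into the space is a total function of which only the values on \<open>C\<close> are
  used.\<close>

definition fixed_points :: "'a set \<Rightarrow> ('a \<Rightarrow> 'a) \<Rightarrow> 'a set" where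
  "fixed_points C T = {z \<in> C. z = T z}"

definition quasinonexpansive :: "'a::real_normed_vector set \<Rightarrow> ('a \<Rightarrow> 'a) \<Rightarrow> bool" where
  "quasinonexpansive C T \<longleftrightarrow>
     fixed_points C T \<noteq> {} \<and>
     (\<forall>z\<in>fixed_points C T. \<forall>x\<in>C. phi z (T x) \<le> phi z x)"

definition strongly_quasinonexpansive ::
    "'a::real_normed_vector set \<Rightarrow> ('a \<Rightarrow> 'a) \<Rightarrow> bool" where
  "strongly_quasinonexpansive C T \<longleftrightarrow>
     fixed_points C T \<noteq> {} \<and>
     (\<forall>z\<in>fixed_points C T. \<forall>M>0. \<forall>\<epsilon>>0. \<exists>\<delta>>0.
        \<forall>x \<in> C \<inter> phi_ball z M. phi z x - phi z (T x) < \<delta> \<longrightarrow> phi (T x) x < \<epsilon>)"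

text \<open>The supremum of a set of reals that is not known to be bounded above is taken in \<open>ereal\<close>,
  since the real-valued \<open>Sup\<close> is unspecified on unbounded sets. \<open>initial_interval \<alpha>\<close> is the
  set of reals in \<open>[0, \<alpha>]\<close>.\<close>

definition initial_interval :: "ereal \<Rightarrow> real set" where
  "initial_interval \<alpha> = {t. 0 \<le> t \<and> ereal t \<le> \<alpha>}"

end

theory Submission
  imports Defs
begin

text \<open>Smoothness alone produces the duality mapping, without the Hahn--Banach theorem: at a unit
  vector the Gateaux derivative of the norm is a linear functional of norm one, and it is the only
  norming functional because every such functional minorizes the difference quotients. Strict
  convexity is needed only for \<open>\<phi>(y, x) = 0 \<Longrightarrow> y = x\<close>, which turns strong quasinonexpansiveness
  into quasinonexpansiveness. For (3) one takes
  \<open>\<gamma>(t) = inf ({M} \<union> {\<phi>(z, x) - \<phi>(z, T x) | x \<in> D, \<phi>(T x, x) \<ge> t})\<close>; the element \<open>M\<close> bounds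
  \<open>\<gamma>\<close> and keeps the set nonempty when \<open>t = \<alpha>\<close> is not attained.\<close>

section \<open>Gateaux derivative of the norm at a unit vector\<close>

lemma smooth_space_direction:
  fixes u y :: "'a::real_normed_vector"
  assumes "smooth_space TYPE('a)" and "norm u = 1"
  obtains l where "((\<lambda>t::real. (norm (u + t *\<^sub>R y) - norm u) / t) \<longlongrightarrow> l) (at 0)"
proof (cases "y = 0")
  case True
  then show ?thesis using that[of 0] by simp
next
  case False
  define v where "v = y /\<^sub>R norm y"
  have "norm v = 1" using False by (simp add: v_def)
  then have "u \<in> sphere 0 1" "v \<in> sphere 0 1" using assms(2) by simp_all
  then obtain l where
    l: "((\<lambda>t::real. (norm (u + t *\<^sub>R v) - norm u) / t) \<longlongrightarrow> l) (at 0)"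
    using assms(1) unfolding smooth_space_def by blast
  \<comment> \<open>Since \<open>y\<close> is \<open>norm y\<close> times the unit vector
    \<open>v\<close>, the quotient for \<open>y\<close> at \<open>t\<close> is \<open>norm y\<close>
    times the quotient for \<open>v\<close> at \<open>norm y * t\<close>. The substitution preserves
    punctured neighbourhoods of 0 because \<open>norm y\<close> is nonzero.\<close>
  have "filterlim (\<lambda>t. norm y * t) (at 0) (at (0::real))"
    unfolding filterlim_at
    using False by (auto intro!: tendsto_eq_intros simp: eventually_at_filter)
  from tendsto_mult[OF tendsto_const[of "norm y"] filterlim_compose[OF l this]]
  have "((\<lambda>t. (norm (u + t *\<^sub>R y) - norm u) / t) \<longlongrightarrow> norm y * l) (at 0)"
    using False by (simp add: v_def mult.commute[of "norm y"] mult.assoc)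
  then show ?thesis by (rule that)
qed

text \<open>\<open>Lim\<close> is a definite description, so the value is meaningful only where the
  limit exists; the context below ensures this by smoothness and a unit base point.\<close>

definition norm_deriv :: "'a::real_normed_vector \<Rightarrow> 'a \<Rightarrow> real" where
  "norm_deriv u y = Lim (at 0) (\<lambda>t::real. (norm (u + t *\<^sub>R y) - norm u) / t)"

context
  fixes u :: "'a::real_normed_vector"
  assumes smooth: "smooth_space TYPE('a)" and u: "norm u = 1"
begin

lemma norm_deriv_tendsto:
  "((\<lambda>t::real. (norm (u + t *\<^sub>R y) - norm u) / t) \<longlongrightarrow> norm_deriv u y) (at 0)"
proof -
  obtain l where l: "((\<lambda>t::real. (norm (u + t *\<^sub>R y) - norm u) / t) \<longlongrightarrow> l) (at 0)"
    by (rule smooth_space_direction[OF smooth u])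
  have "norm_deriv u y = l"
    unfolding norm_deriv_def by (rule tendsto_Lim[OF _ l]) simp
  with l show ?thesis by simp
qed

text \<open>Estimates of the quotient are proved for positive \<open>t\<close>, where division by
  \<open>t\<close> keeps the direction of an inequality; the one-sided limit suffices to carry them
  over to the derivative.\<close>

lemma norm_deriv_tendsto_right:
  "((\<lambda>t::real. (norm (u + t *\<^sub>R y) - norm u) / t) \<longlongrightarrow> norm_deriv u y) (at_right 0)"
  using norm_deriv_tendsto by (rule tendsto_mono[rotated]) (simp add: at_le)

text \<open>Substitute \<open>c * t\<close> for \<open>t\<close>. Negative \<open>c\<close> is
  covered because the limit is two-sided; this is the source of oddness, hence of linearity.\<close>

lemma norm_deriv_scaleR: "norm_deriv u (c *\<^sub>R y) = c * norm_deriv u y"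
proof (cases "c = 0")
  case True
  then show ?thesis
    using norm_deriv_tendsto[of 0] by (simp add: tendsto_const_iff)
next
  case False
  have "filterlim (\<lambda>t. c * t) (at 0) (at (0::real))"
    unfolding filterlim_at
    using False by (auto intro!: tendsto_eq_intros simp: eventually_at_filter)
  from tendsto_mult[OF tendsto_const[of c] filterlim_compose[OF norm_deriv_tendsto[of y] this]]
  have "((\<lambda>t. (norm (u + t *\<^sub>R (c *\<^sub>R y)) - norm u) / t) \<longlongrightarrow> c * norm_deriv u y) (at 0)"
    using False by (simp add: mult.commute)
  then show ?thesis
    using norm_deriv_tendsto[of "c *\<^sub>R y"] tendsto_unique trivial_limit_at by blast
qed

text \<open>Convexity of the norm: \<open>u + t *\<^sub>R (y + z)\<close> is the midpoint of
  \<open>u + (2 * t) *\<^sub>R y\<close> and \<open>u + (2 * t) *\<^sub>R z\<close>. The doubled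
  step does not change the limits.\<close>

lemma norm_deriv_add_le: "norm_deriv u (y + z) \<le> norm_deriv u y + norm_deriv u z"
proof -
  have two: "((\<lambda>t::real. (norm (u + (2 * t) *\<^sub>R y) - norm u) / (2 * t)) \<longlongrightarrow> norm_deriv u y)
    (at_right 0)" for y
  proof -
    have "filterlim (\<lambda>t. 2 * t) (at_right 0) (at_right (0::real))"
      unfolding filterlim_at
      by (auto intro!: tendsto_eq_intros simp: eventually_at_filter)
    from filterlim_compose[OF norm_deriv_tendsto_right this] show ?thesis .
  qed
  show ?thesis
  proof (rule tendsto_le[OF _ tendsto_add[OF two[of y] two[of z]] norm_deriv_tendsto_right])
    have "(norm (u + t *\<^sub>R (y + z)) - norm u) / t \<le>
      (norm (u + (2 * t) *\<^sub>R y) - norm u) / (2 * t) + (norm (u + (2 * t) *\<^sub>R z) - norm u) / (2 * t)"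
      if "t > 0" for t :: real
    proof -
      have "2 * norm (u + t *\<^sub>R (y + z)) = norm ((u + (2 * t) *\<^sub>R y) + (u + (2 * t) *\<^sub>R z))"
      proof -
        have "(u + (2 * t) *\<^sub>R y) + (u + (2 * t) *\<^sub>R z) = 2 *\<^sub>R (u + t *\<^sub>R (y + z))"
          by (simp add: algebra_simps flip: scaleR_2)
        then show ?thesis by simp
      qed
      also have "\<dots> \<le> norm (u + (2 * t) *\<^sub>R y) + norm (u + (2 * t) *\<^sub>R z)"
        by (rule norm_triangle_ineq)
      finally have "norm (u + t *\<^sub>R (y + z)) - norm u \<le>
        ((norm (u + (2 * t) *\<^sub>R y) - norm u) + (norm (u + (2 * t) *\<^sub>R z) - norm u)) / 2"
        by simp
      from divide_right_mono[OF this less_imp_le[OF that]] show ?thesis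
        by (simp only: divide_divide_eq_left flip: add_divide_distrib)
    qed
    then show "\<forall>\<^sub>F t in at_right 0. (norm (u + t *\<^sub>R (y + z)) - norm u) / t \<le>
      (norm (u + (2 * t) *\<^sub>R y) - norm u) / (2 * t) + (norm (u + (2 * t) *\<^sub>R z) - norm u) / (2 * t)"
      by (auto simp: eventually_at_filter)
  qed simp
qed

lemma norm_deriv_uminus: "norm_deriv u (- y) = - norm_deriv u y"
  using norm_deriv_scaleR[of "-1" y] by simp

text \<open>Subadditivity at \<open>- y\<close> and \<open>- z\<close> becomes, by oddness, the
  reverse inequality at \<open>y\<close> and \<open>z\<close>.\<close>

lemma norm_deriv_add: "norm_deriv u (y + z) = norm_deriv u y + norm_deriv u z"
  using norm_deriv_add_le[of y z] norm_deriv_add_le[of "- y" "- z"]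
    norm_deriv_uminus[of y] norm_deriv_uminus[of z] norm_deriv_uminus[of "y + z"]
  by simp

lemma norm_deriv_le: "norm_deriv u y \<le> norm y"
proof (rule tendsto_upperbound[OF norm_deriv_tendsto_right])
  have "(norm (u + t *\<^sub>R y) - norm u) / t \<le> norm y" if "t > 0" for t :: real
    using that norm_triangle_ineq[of u "t *\<^sub>R y"] by (simp add: field_simps)
  then show "\<forall>\<^sub>F t in at_right 0. (norm (u + t *\<^sub>R y) - norm u) / t \<le> norm y"
    by (auto simp: eventually_at_filter)
qed simp

lemma abs_norm_deriv_le: "\<bar>norm_deriv u y\<bar> \<le> norm y"
  using norm_deriv_le[of y] norm_deriv_le[of "- y"] norm_deriv_uminus[of y] by simp

lemma bounded_linear_norm_deriv: "bounded_linear (norm_deriv u)"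
  by (rule bounded_linear_intro[where K = 1])
    (simp_all add: norm_deriv_add norm_deriv_scaleR abs_norm_deriv_le)

text \<open>For positive \<open>t\<close>, evaluating \<open>f\<close> at
  \<open>u + t *\<^sub>R y\<close> gives \<open>1 + t * f y\<close>, which is at most the norm of
  that point; subtract 1, divide by \<open>t\<close> and let \<open>t\<close> tend to 0.\<close>

lemma norm_deriv_ge_blinfun:
  assumes "norm f \<le> 1" and "blinfun_apply f u = 1"
  shows "blinfun_apply f y \<le> norm_deriv u y"
proof (rule tendsto_lowerbound[OF norm_deriv_tendsto_right])
  have "blinfun_apply f y \<le> (norm (u + t *\<^sub>R y) - norm u) / t" if "t > 0" for t :: real
  proof -
    have "1 + t * blinfun_apply f y = blinfun_apply f (u + t *\<^sub>R y)"
      using assms(2) by (simp add: blinfun.add_right blinfun.scaleR_right)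
    also have "\<dots> \<le> norm f * norm (u + t *\<^sub>R y)"
      using norm_blinfun[of f "u + t *\<^sub>R y"] by simp
    also have "\<dots> \<le> norm (u + t *\<^sub>R y)"
      using assms(1) by (simp add: mult_left_le_one_le)
    finally show ?thesis using that u by (simp add: field_simps)
  qed
  then show "\<forall>\<^sub>F t in at_right 0. blinfun_apply f y \<le> (norm (u + t *\<^sub>R y) - norm u) / t"
    by (auto simp: eventually_at_filter)
qed simp

text \<open>Both sides are odd in \<open>y\<close>, so the inequality at \<open>y\<close> and at
  \<open>- y\<close> forces equality. This yields uniqueness of the norming functional.\<close>

lemma blinfun_eq_norm_deriv:
  assumes "norm f \<le> 1" and "blinfun_apply f u = 1"
  shows "blinfun_apply f y = norm_deriv u y"
  using norm_deriv_ge_blinfun[OF assms, of y] norm_deriv_ge_blinfun[OF assms, of "- y"]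
  by (simp add: norm_deriv_uminus blinfun.minus_right)

lemma norm_deriv_self: "norm_deriv u u = 1"
proof (rule tendsto_unique[OF _ norm_deriv_tendsto_right])
  have "(norm (u + t *\<^sub>R u) - norm u) / t = 1" if "t > 0" for t :: real
  proof -
    have "u + t *\<^sub>R u = (1 + t) *\<^sub>R u" by (simp add: scaleR_add_left)
    then show ?thesis using that u by simp
  qed
  then have "\<forall>\<^sub>F t in at_right 0. (norm (u + t *\<^sub>R u) - norm u) / t = 1"
    by (auto simp: eventually_at_filter)
  then show "((\<lambda>t::real. (norm (u + t *\<^sub>R u) - norm u) / t) \<longlongrightarrow> 1) (at_right 0)"
    by (rule tendsto_eventually)
qed simp

lemma ex1_norming_functional: "\<exists>!f :: 'a \<Rightarrow>\<^sub>L real. blinfun_apply f u = 1 \<and> norm f = 1"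
proof
  let ?f = "Blinfun (norm_deriv u)"
  have app: "blinfun_apply ?f = norm_deriv u"
    by (rule bounded_linear_Blinfun_apply[OF bounded_linear_norm_deriv])
  have "norm ?f \<le> 1"
    by (rule norm_blinfun_bound) (simp_all add: app abs_norm_deriv_le)
  moreover have "norm ?f \<ge> 1"
    using norm_blinfun[of ?f u] u by (simp add: app norm_deriv_self)
  ultimately show "blinfun_apply ?f u = 1 \<and> norm ?f = 1"
    by (simp add: app norm_deriv_self)
  show "f = ?f" if "blinfun_apply f u = 1 \<and> norm f = 1" for f :: "'a \<Rightarrow>\<^sub>L real"
    using that by (intro blinfun_eqI) (simp add: app blinfun_eq_norm_deriv)
qed

end

section \<open>The normalized duality mapping\<close>

lemma ex1_duality_functional:
  fixes x :: "'a::real_normed_vector"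
  assumes "smooth_space TYPE('a)"
  shows "\<exists>!f. blinfun_apply f x = (norm x)\<^sup>2 \<and> (norm x)\<^sup>2 = (norm f)\<^sup>2"
proof (cases "x = 0")
  case True
  \<comment> \<open>At the origin the norm condition leaves only the zero functional.\<close>
  then show ?thesis by (auto intro!: ex1I[of _ 0])
next
  case False
  then have "norm (x /\<^sub>R norm x) = 1" by simp
  from ex1_norming_functional[OF assms this] obtain g :: "'a \<Rightarrow>\<^sub>L real" where
    g: "blinfun_apply g (x /\<^sub>R norm x) = 1" "norm g = 1"
    and uniq: "\<And>h. blinfun_apply h (x /\<^sub>R norm x) = 1 \<Longrightarrow> norm h = 1 \<Longrightarrow> h = g"
    by metis
  show ?thesis
  \<comment> \<open>Rescaling by \<open>norm x\<close> matches functionals norming the normalized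
    vector with functionals satisfying the duality conditions at \<open>x\<close>.\<close>
  proof (rule ex1I[of _ "norm x *\<^sub>R g"])
    show "blinfun_apply (norm x *\<^sub>R g) x = (norm x)\<^sup>2 \<and> (norm x)\<^sup>2 = (norm (norm x *\<^sub>R g))\<^sup>2"
      using g False
      by (simp add: blinfun.scaleR_left blinfun.scaleR_right field_simps power2_eq_square)
  next
    fix f assume f: "blinfun_apply f x = (norm x)\<^sup>2 \<and> (norm x)\<^sup>2 = (norm f)\<^sup>2"
    then have "norm f = norm x" by simp
    have "f /\<^sub>R norm x = g"
      using f \<open>norm f = norm x\<close> False
      by (intro uniq) (simp_all add: blinfun.scaleR_left blinfun.scaleR_right power2_eq_square
          field_simps)
    then show "f = norm x *\<^sub>R g" using False by auto
  qed
qed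

lemma
  fixes x :: "'a::real_normed_vector"
  assumes "smooth_space TYPE('a)"
  shows duality_map_self: "blinfun_apply (duality_map x) x = (norm x)\<^sup>2"
    and norm_duality_map: "norm (duality_map x) = norm x"
  \<comment> \<open>Existence and uniqueness make the definite description in
    \<open>duality_map\<close> proper, so its defining property holds.\<close>
  using theI'[OF ex1_duality_functional[OF assms, of x], folded duality_map_def] by simp_all

lemma duality_map_le:
  fixes x y :: "'a::real_normed_vector"
  assumes "smooth_space TYPE('a)"
  shows "blinfun_apply (duality_map y) x \<le> norm y * norm x"
  using norm_blinfun[of "duality_map y" x] norm_duality_map[OF assms, of y] by simp

section \<open>Lower bound and zeros of \<open>phi\<close>\<close>

lemma phi_ge:
  fixes x y :: "'a::real_normed_vector"
  assumes "smooth_space TYPE('a)"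
  shows "(norm x - norm y)\<^sup>2 \<le> phi x y"
  \<comment> \<open>The right side minus the left side is twice the gap between
    \<open>norm y * norm x\<close> and the value of \<open>duality_map y\<close> at
    \<open>x\<close>.\<close>
  using duality_map_le[OF assms, of y x]
  by (simp add: phi_def power2_eq_square algebra_simps)

lemma phi_nonneg:
  fixes x y :: "'a::real_normed_vector"
  assumes "smooth_space TYPE('a)"
  shows "0 \<le> phi x y"
  using phi_ge[OF assms, of x y] zero_le_power2[of "norm x - norm y"] by linarith

text \<open>A zero of \<open>phi\<close> forces equal norms and makes \<open>duality_map y\<close>
  attain its norm at both normalized vectors, hence at their midpoint. That midpoint then has norm
  at least 1, which strict convexity forbids for distinct vectors.\<close>

lemma phi_eq_zeroD:
  fixes x y :: "'a::real_normed_vector"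
  assumes smooth: "smooth_space TYPE('a)" and sc: "strictly_convex_space TYPE('a)"
    and "phi x y = 0"
  shows "x = y"
proof (rule ccontr)
  assume "x \<noteq> y"
  have eq: "norm x = norm y" using phi_ge[OF smooth, of x y] assms(3) by simp
  with \<open>x \<noteq> y\<close> have pos: "norm y > 0" by auto
  have "blinfun_apply (duality_map y) x = (norm y)\<^sup>2"
    using assms(3) eq by (simp add: phi_def)
  then have "2 * (norm y * norm y) = blinfun_apply (duality_map y) (x + y)"
    by (simp add: blinfun.add_right duality_map_self[OF smooth] power2_eq_square)
  also have "\<dots> \<le> norm y * norm (x + y)" by (rule duality_map_le[OF smooth])
  finally have ge: "2 * norm y \<le> norm (x + y)" using pos by simp
  have "norm ((1/2) *\<^sub>R (x /\<^sub>R norm y + y /\<^sub>R norm y)) < 1"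
    using sc pos eq \<open>x \<noteq> y\<close> by (auto simp: strictly_convex_space_def)
  moreover have "(1/2) *\<^sub>R (x /\<^sub>R norm y + y /\<^sub>R norm y) = (1 / (2 * norm y)) *\<^sub>R (x + y)"
    by (simp add: scaleR_add_right divide_simps)
  ultimately have "1 / (2 * norm y) * norm (x + y) < 1"
    by (simp only: norm_scaleR) simp
  then show False using ge pos by (simp add: field_simps)
qed

text \<open>If \<open>phi z (T x)\<close> exceeded \<open>phi z x\<close>, the decrease would be
  negative, hence below every \<delta>. Then \<open>phi (T x) x\<close> would be below every
  positive \<epsilon>, so it would vanish and \<open>x\<close> would be fixed, a
  contradiction.\<close>

lemma strongly_quasinonexpansive_imp_quasinonexpansive:
  fixes C :: "'a::real_normed_vector set"
  assumes "smooth_space TYPE('a)" and "strictly_convex_space TYPE('a)"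
    and S: "strongly_quasinonexpansive C T"
  shows "quasinonexpansive C T"
  unfolding quasinonexpansive_def
proof (intro conjI ballI)
  show "fixed_points C T \<noteq> {}" using S by (simp add: strongly_quasinonexpansive_def)
  fix z x assume z: "z \<in> fixed_points C T" and x: "x \<in> C"
  show "phi z (T x) \<le> phi z x"
  proof (rule ccontr)
    assume less: "\<not> phi z (T x) \<le> phi z x"
    \<comment> \<open>The maximum with 1 keeps the radius positive when \<open>phi z x\<close> is
      0.\<close>
    define M where "M = max 1 (phi z x)"
    have "M > 0" and mem: "x \<in> C \<inter> phi_ball z M" using x by (auto simp: M_def phi_ball_def)
    have "phi (T x) x < \<epsilon>" if "\<epsilon> > 0" for \<epsilon>
    proof -
      obtain \<delta> where "\<delta> > 0" and
        "\<forall>x \<in> C \<inter> phi_ball z M. phi z x - phi z (T x) < \<delta> \<longrightarrow> phi (T x) x < \<epsilon>"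
        using S z \<open>M > 0\<close> \<open>\<epsilon> > 0\<close> unfolding strongly_quasinonexpansive_def by meson
      then show ?thesis using mem less by auto
    qed
    then have "phi (T x) x = 0"
      using phi_nonneg[OF assms(1), of "T x" x] by (metis less_irrefl order_le_less)
    then have "T x = x" by (rule phi_eq_zeroD[OF assms(1,2)])
    with less show False by simp
  qed
qed

section \<open>Moduli and sequences\<close>

lemma sequential_modulus_iff:
  fixes g h :: "'a \<Rightarrow> real"
  assumes g: "\<And>x. x \<in> D \<Longrightarrow> 0 \<le> g x" and h: "\<And>x. x \<in> D \<Longrightarrow> 0 \<le> h x"
  shows "(\<forall>\<epsilon>>0. \<exists>\<delta>>0. \<forall>x\<in>D. g x < \<delta> \<longrightarrow> h x < \<epsilon>) \<longleftrightarrow>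
    (\<forall>x :: nat \<Rightarrow> 'a. (\<forall>n. x n \<in> D) \<longrightarrow> (\<lambda>n. g (x n)) \<longlonglongrightarrow> 0 \<longrightarrow> (\<lambda>n. h (x n)) \<longlonglongrightarrow> 0)"
    (is "?L \<longleftrightarrow> ?R")
proof
  assume L: ?L
  show ?R
  proof (intro allI impI)
    fix x :: "nat \<Rightarrow> 'a"
    assume x: "\<forall>n. x n \<in> D" and lim: "(\<lambda>n. g (x n)) \<longlonglongrightarrow> 0"
    show "(\<lambda>n. h (x n)) \<longlonglongrightarrow> 0"
    proof (rule tendstoI)
      fix \<epsilon> :: real assume "\<epsilon> > 0"
      with L obtain \<delta> where "\<delta> > 0" and \<delta>: "\<forall>x\<in>D. g x < \<delta> \<longrightarrow> h x < \<epsilon>" by blast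
      from order_tendstoD(2)[OF lim \<open>\<delta> > 0\<close>]
      show "\<forall>\<^sub>F n in sequentially. dist (h (x n)) 0 < \<epsilon>"
        \<comment> \<open>Nonnegativity of \<open>h\<close> turns the one-sided bound into a
          distance bound.\<close>
        by eventually_elim (use x \<delta> h in \<open>auto simp: dist_real_def\<close>)
    qed
  qed
next
  assume R: ?R
  show ?L
  proof (rule ccontr)
    assume "\<not> ?L"
    then obtain \<epsilon> where "\<epsilon> > 0" and bad: "\<And>\<delta>. \<delta> > 0 \<Longrightarrow> \<exists>x\<in>D. g x < \<delta> \<and> \<epsilon> \<le> h x"
      by (meson not_less)
    \<comment> \<open>Failure for the thresholds \<open>1 / (n + 1)\<close> gives a sequence on
      which \<open>g\<close> tends to 0, being nonnegative, while \<open>h\<close> stays at least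
      \<epsilon>.\<close>
    have "\<forall>n::nat. \<exists>x. x \<in> D \<and> g x < inverse (real (Suc n)) \<and> \<epsilon> \<le> h x"
      using bad by (metis inverse_positive_iff_positive of_nat_0_less_iff zero_less_Suc)
    then obtain x where x: "\<And>n::nat. x n \<in> D \<and> g (x n) < inverse (real (Suc n)) \<and> \<epsilon> \<le> h (x n)"
      by metis
    have "(\<lambda>n. g (x n)) \<longlonglongrightarrow> 0"
      by (rule tendsto_sandwich[OF _ _ tendsto_const LIMSEQ_inverse_real_of_nat])
        (use x g in \<open>auto intro!: always_eventually less_imp_le\<close>)
    with R x have "(\<lambda>n. h (x n)) \<longlonglongrightarrow> 0" by blast
    from order_tendstoD(2)[OF this \<open>\<epsilon> > 0\<close>] x show False
      by (auto simp: not_less[symmetric] eventually_sequentially)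
  qed
qed

text \<open>Quasinonexpansiveness supplies the nonnegative decrease required to apply the abstract
  equivalence for each \<open>z\<close> and \<open>M\<close>.\<close>

lemma strongly_quasinonexpansive_iff_sequential:
  fixes C :: "'a::real_normed_vector set"
  assumes smooth: "smooth_space TYPE('a)" and Q: "quasinonexpansive C T"
  shows "strongly_quasinonexpansive C T \<longleftrightarrow>
    (\<forall>z\<in>fixed_points C T. \<forall>M>0. \<forall>x :: nat \<Rightarrow> 'a.
       (\<forall>n. x n \<in> C \<inter> phi_ball z M) \<longrightarrow>
       (\<lambda>n. phi z (x n) - phi z (T (x n))) \<longlonglongrightarrow> 0 \<longrightarrow>
       (\<lambda>n. phi (T (x n)) (x n)) \<longlonglongrightarrow> 0)"
proof -
  have "(\<forall>\<epsilon>>0. \<exists>\<delta>>0. \<forall>x \<in> C \<inter> phi_ball z M. phi z x - phi z (T x) < \<delta> \<longrightarrow> phi (T x) x < \<epsilon>)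
    \<longleftrightarrow> (\<forall>x :: nat \<Rightarrow> 'a. (\<forall>n. x n \<in> C \<inter> phi_ball z M) \<longrightarrow>
       (\<lambda>n. phi z (x n) - phi z (T (x n))) \<longlonglongrightarrow> 0 \<longrightarrow>
       (\<lambda>n. phi (T (x n)) (x n)) \<longlonglongrightarrow> 0)" if "z \<in> fixed_points C T" for z M
    using Q that by (intro sequential_modulus_iff)
      (auto simp: quasinonexpansive_def phi_nonneg[OF smooth])
  then show ?thesis
    using Q by (simp add: strongly_quasinonexpansive_def quasinonexpansive_def)
qed

section \<open>Moduli as nondecreasing functions\<close>

lemma ex_modulus_function:
  fixes g h :: "'a \<Rightarrow> real"
  assumes "0 < M" and g: "\<And>x. x \<in> D \<Longrightarrow> 0 \<le> g x"
    and modulus: "\<forall>\<epsilon>>0. \<exists>\<delta>>0. \<forall>x\<in>D. g x < \<delta> \<longrightarrow> h x < \<epsilon>"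
  shows "\<exists>\<gamma> :: real \<Rightarrow> real. (\<forall>t. 0 \<le> \<gamma> t) \<and> mono \<gamma> \<and> (\<forall>t. \<gamma> t \<le> M) \<and>
    (\<forall>t>0. 0 < \<gamma> t) \<and> (\<forall>x\<in>D. \<gamma> (h x) \<le> g x)"
proof -
  define A where "A t = insert M (g ` {x \<in> D. t \<le> h x})" for t
  define \<gamma> where "\<gamma> t = Inf (A t)" for t
  have ge: "c \<le> \<gamma> t" if "\<And>a. a \<in> A t \<Longrightarrow> c \<le> a" for c t
    unfolding \<gamma>_def by (rule cInf_greatest) (use that in \<open>auto simp: A_def\<close>)
  have le: "\<gamma> t \<le> a" if "a \<in> A t" for a t
    unfolding \<gamma>_def
    by (rule cInf_lower[OF that]) (use assms(1) g in \<open>auto simp: A_def intro!: bdd_belowI[of _ 0]\<close>)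
  have "0 \<le> \<gamma> t" for t by (rule ge) (use assms(1) g in \<open>auto simp: A_def\<close>)
  moreover have "mono \<gamma>"
    \<comment> \<open>A larger \<open>t\<close> shrinks \<open>A t\<close>, so the infimum can only
      grow.\<close>
    by (intro monoI ge le) (auto simp: A_def)
  moreover have "\<gamma> t \<le> M" for t by (rule le) (simp add: A_def)
  moreover have "0 < \<gamma> t" if "0 < t" for t
  proof -
    obtain \<delta> where "\<delta> > 0" and \<delta>: "\<forall>x\<in>D. g x < \<delta> \<longrightarrow> h x < t"
      using modulus \<open>0 < t\<close> by blast
    \<comment> \<open>The modulus at level \<open>t\<close> keeps \<open>g\<close> at least \<delta>
      wherever \<open>h\<close> is at least \<open>t\<close>.\<close>
    have "min \<delta> M \<le> \<gamma> t"
    proof (rule ge)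
      fix a assume "a \<in> A t"
      then consider "a = M" | x where "x \<in> D" "t \<le> h x" "a = g x" by (auto simp: A_def)
      then show "min \<delta> M \<le> a"
      proof cases
        case 2
        then have "\<delta> \<le> g x" using \<delta> by (meson not_less)
        with 2 show ?thesis by simp
      qed simp
    qed
    then show ?thesis using \<open>\<delta> > 0\<close> \<open>0 < M\<close> by linarith
  qed
  moreover have "\<gamma> (h x) \<le> g x" if "x \<in> D" for x by (rule le) (use that in \<open>auto simp: A_def\<close>)
  ultimately show ?thesis by blast
qed

text \<open>Within \<open>I\<close> the choice \<delta> = \<open>\<gamma> \<epsilon>\<close> works:
  a point with \<open>h x\<close> at least \<epsilon> would satisfy
  \<open>\<gamma> \<epsilon> \<le> \<gamma> (h x) \<le> g x\<close>.\<close>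

lemma modulus_function_imp_modulus:
  fixes g h :: "'a \<Rightarrow> real" and D :: "'a set" and \<epsilon> :: real
  defines "I \<equiv> initial_interval (SUP x\<in>D. ereal (h x))"
  assumes h: "\<And>x. x \<in> D \<Longrightarrow> 0 \<le> h x"
    and mono: "mono_on I \<gamma>" and pos: "\<forall>t\<in>I. 0 < t \<longrightarrow> 0 < \<gamma> t"
    and le: "\<forall>x\<in>D. \<gamma> (h x) \<le> g x" and "0 < \<epsilon>"
  shows "\<exists>\<delta>>0. \<forall>x\<in>D. g x < \<delta> \<longrightarrow> h x < \<epsilon>"
proof -
  have hI: "h x \<in> I" if "x \<in> D" for x
    using that h by (auto simp: I_def initial_interval_def intro: SUP_upper)
  show ?thesis
  proof (cases "\<epsilon> \<in> I")
    case True
    have "h x < \<epsilon>" if "x \<in> D" "g x < \<gamma> \<epsilon>" for x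
      using that mono_onD[OF mono True hI[OF that(1)]] le by force
    then show ?thesis using pos True \<open>0 < \<epsilon>\<close> by blast
  next
    \<comment> \<open>Here \<epsilon> lies above the supremum, so every \<delta> works. This
      includes an empty \<open>D\<close>, whose supremum in \<open>ereal\<close> is minus infinity
      and whose \<open>I\<close> is empty.\<close>
    case False
    have "h x < \<epsilon>" if "x \<in> D" for x
    proof (rule ccontr)
      assume "\<not> h x < \<epsilon>"
      then have "ereal \<epsilon> \<le> ereal (h x)" by simp
      also have "\<dots> \<le> (SUP x\<in>D. ereal (h x))" using that by (rule SUP_upper)
      finally show False using False \<open>0 < \<epsilon>\<close> by (simp add: I_def initial_interval_def)
    qed
    then show ?thesis by (meson zero_less_one)
  qed
qed

theorem theorem5p3:
  fixes C :: "'a::banach set" and T :: "'a \<Rightarrow> 'a"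
  assumes smooth: "smooth_space TYPE('a)"
    and strictly_convex: "strictly_convex_space TYPE('a)"
    and C_nonempty: "C \<noteq> {}"
    and F_nonempty: "fixed_points C T \<noteq> {}"
  defines "P1 \<equiv> strongly_quasinonexpansive C T"
    and "P2 \<equiv> quasinonexpansive C T \<and>
      (\<forall>z\<in>fixed_points C T. \<forall>M>0. \<forall>x :: nat \<Rightarrow> 'a.
         (\<forall>n. x n \<in> C \<inter> phi_ball z M) \<longrightarrow>
         (\<lambda>n. phi z (x n) - phi z (T (x n))) \<longlonglongrightarrow> 0 \<longrightarrow>
         (\<lambda>n. phi (T (x n)) (x n)) \<longlonglongrightarrow> 0)"
    and "P3 \<equiv> (\<forall>z\<in>fixed_points C T. \<forall>M>0.
      let D = C \<inter> phi_ball z M;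
          \<alpha> = (SUP x\<in>D. ereal (phi (T x) x));
          I = initial_interval \<alpha>
      in \<exists>\<gamma> :: real \<Rightarrow> real.
           (\<forall>t\<in>I. 0 \<le> \<gamma> t) \<and> mono_on I \<gamma> \<and> bounded (\<gamma> ` I) \<and>
           (\<forall>t\<in>I. 0 < t \<longrightarrow> 0 < \<gamma> t) \<and>
           (\<forall>x\<in>D. \<gamma> (phi (T x) x) \<le> phi z x - phi z (T x)))"
  shows "(P1 \<longleftrightarrow> P2) \<and> (P2 \<longleftrightarrow> P3)"
proof -
  have qne: "P1 \<Longrightarrow> quasinonexpansive C T"
    unfolding P1_def
    by (rule strongly_quasinonexpansive_imp_quasinonexpansive[OF smooth strictly_convex])
  \<comment> \<open>The sequential equivalence presupposes quasinonexpansiveness, which (2) contains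
    and (1) implies. The link between (2) and (3) then passes through (1).\<close>
  have P12: "P1 \<longleftrightarrow> P2"
    using qne strongly_quasinonexpansive_iff_sequential[OF smooth, of C T]
    unfolding P1_def P2_def by blast
  have "P3" if P1
    unfolding P3_def Let_def
  proof (intro ballI allI impI)
    fix z and M :: real assume z: "z \<in> fixed_points C T" and "0 < M"
    let ?D = "C \<inter> phi_ball z M"
    let ?I = "initial_interval (SUP x\<in>?D. ereal (phi (T x) x))"
    have "\<forall>\<epsilon>>0. \<exists>\<delta>>0. \<forall>x\<in>?D. phi z x - phi z (T x) < \<delta> \<longrightarrow> phi (T x) x < \<epsilon>"
      using \<open>P1\<close> z \<open>0 < M\<close> unfolding P1_def strongly_quasinonexpansive_def by blast
    moreover have "0 \<le> phi z x - phi z (T x)" if "x \<in> ?D" for x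
      using qne[OF \<open>P1\<close>] z that by (auto simp: quasinonexpansive_def)
    ultimately obtain \<gamma> :: "real \<Rightarrow> real" where \<gamma>: "\<forall>t. 0 \<le> \<gamma> t" "mono \<gamma>" "\<forall>t. \<gamma> t \<le> M"
      "\<forall>t>0. 0 < \<gamma> t" "\<forall>x\<in>?D. \<gamma> (phi (T x) x) \<le> phi z x - phi z (T x)"
      using ex_modulus_function[OF \<open>0 < M\<close>, of ?D "\<lambda>x. phi z x - phi z (T x)" "\<lambda>x. phi (T x) x"]
      by blast
    \<comment> \<open>\<open>\<gamma>\<close> is defined on the whole line with values between 0 and
      \<open>M\<close>; only its restriction to the interval is kept.\<close>
    have "bounded (\<gamma> ` ?I)"
      using \<gamma>(1,3) by (intro boundedI[of _ M]) auto
    with \<gamma> show "\<exists>\<gamma> :: real \<Rightarrow> real. (\<forall>t\<in>?I. 0 \<le> \<gamma> t) \<and> mono_on ?I \<gamma> \<and> bounded (\<gamma> ` ?I) \<and>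
      (\<forall>t\<in>?I. 0 < t \<longrightarrow> 0 < \<gamma> t) \<and> (\<forall>x\<in>?D. \<gamma> (phi (T x) x) \<le> phi z x - phi z (T x))"
      by (intro exI[of _ \<gamma>]) (auto intro: mono_on_subset)
  qed
  moreover have "P1" if P3
    unfolding P1_def strongly_quasinonexpansive_def
  proof (intro conjI ballI allI impI F_nonempty)
    fix z and M \<epsilon> :: real assume "z \<in> fixed_points C T" and "0 < M" and "0 < \<epsilon>"
    let ?D = "C \<inter> phi_ball z M"
    let ?I = "initial_interval (SUP x\<in>?D. ereal (phi (T x) x))"
    obtain \<gamma> :: "real \<Rightarrow> real" where "mono_on ?I \<gamma>" "\<forall>t\<in>?I. 0 < t \<longrightarrow> 0 < \<gamma> t"
      "\<forall>x\<in>?D. \<gamma> (phi (T x) x) \<le> phi z x - phi z (T x)"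
      using \<open>P3\<close> \<open>z \<in> fixed_points C T\<close> \<open>0 < M\<close> unfolding P3_def Let_def by meson
    then show "\<exists>\<delta>>0. \<forall>x\<in>?D. phi z x - phi z (T x) < \<delta> \<longrightarrow> phi (T x) x < \<epsilon>"
      by (rule modulus_function_imp_modulus[OF phi_nonneg[OF smooth] _ _ _ \<open>0 < \<epsilon>\<close>])
  qed
  ultimately show ?thesis using P12 by blast
qed

end
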